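(* Let $p$ be a prime. For any finite $p$-group $G$, the matching number of the power graph of $G$ is $$\alpha'(\mathcal{P}(G)) = \begin{cases} \dfrac{|G|-1}{2} & \text{if } p > 2,\\[2mm] \dfrac{|G|-(t-1)}{2} & \text{if } p = 2, \end{cases}$$ where $t$ is the number of involutions in $G$.
   Context: The power graph $\mathcal{P}(G)$ of a group $G$ is the simple undirected graph with vertex set $G$ in which two distinct vertices are adjacent if and only if one of them is a power of the other. (For finite $p$-groups it coincides with the enhanced power graph, in which two distinct elements are adjacent when they lie in a common cyclic subgroup.) An involution is an element of order $2$. The matching number $\alpha'(\Gamma)$ of a graph $\Gamma$ is the maximum cardinality of a set of edges no two of which share an endpoint.
   Formalization: For p = 2 the group G is assumed nontrivial: for the trivial group |G| = 1 and t = 0, so the stated formula would give 1, while the one-vertex power graph has matching number 0. *)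

theory Defs
  imports Complex_Main "HOL-Algebra.Multiplicative_Group" "HOL-Computational_Algebra.Primes"
begin

text \<open>A simple undirected graph is a pair of a vertex set and a set of edges, each edge being a
  two-element set of vertices.\<close>

type_synonym 'v ugraph = "'v set \<times> 'v set set"

definition simple_graph :: "'v ugraph \<Rightarrow> bool" where
  "simple_graph \<Gamma> \<longleftrightarrow> (\<forall>e \<in> snd \<Gamma>. e \<subseteq> fst \<Gamma> \<and> card e = 2)"

definition is_matching :: "'v ugraph \<Rightarrow> 'v set set \<Rightarrow> bool" where
  "is_matching \<Gamma> M \<longleftrightarrow> M \<subseteq> snd \<Gamma> \<and> pairwise disjnt M"

text \<open>Only meaningful for a graph with finitely many edges, where the maximum exists.\<close>

definition matching_number :: "'v ugraph \<Rightarrow> nat" where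
  "matching_number \<Gamma> = Max {card M | M. is_matching \<Gamma> M}"

text \<open>Powers are taken with integer exponents, as usual in a group; in a finite group
  natural exponents give the same graph.\<close>

definition is_power_of :: "('a, 'b) monoid_scheme \<Rightarrow> 'a \<Rightarrow> 'a \<Rightarrow> bool" where
  "is_power_of G y x \<longleftrightarrow> (\<exists>k::int. y = x [^]\<^bsub>G\<^esub> k)"

definition power_graph :: "('a, 'b) monoid_scheme \<Rightarrow> 'a ugraph" where
  "power_graph G =
     (carrier G,
      {{x, y} | x y. x \<in> carrier G \<and> y \<in> carrier G \<and> x \<noteq> y \<and>
                     (is_power_of G y x \<or> is_power_of G x y)})"

definition involutions :: "('a, 'b) monoid_scheme \<Rightarrow> 'a set" where
  "involutions G = {x \<in> carrier G. group.ord G x = 2}"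

lemma simple_graph_power_graph: "simple_graph (power_graph G)"
  by (auto simp: simple_graph_def power_graph_def)

end

theory Submission
  imports Defs
begin

text \<open>Pairing each element with its inverse gives a matching that misses only the identity and the
  involutions; one further edge joins the identity to an involution, if there is one. For odd \<open>p\<close>
  this is a matching missing a single vertex. For \<open>p = 2\<close> it is optimal by the easy direction of the
  Tutte--Berge formula: deleting the identity splits the power graph into \<open>t\<close> parts with no edge
  between them, according to the unique involution that is a power of a given element, and each
  part is closed under inversion with exactly one fixed point, hence is odd.\<close>

section \<open>Matchings in finite graphs and the odd-parts bound\<close>

lemma card_Union_matching:
  assumes "simple_graph \<Gamma>" "is_matching \<Gamma> M"
  shows "card (\<Union>M) = 2 * card M"
proof -
  have e: "card e = 2" if "e \<in> M" for e
    using assms that by (auto simp: simple_graph_def is_matching_def)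
  then have "finite e" if "e \<in> M" for e
    using that by (metis card.infinite zero_neq_numeral)
  then have "card (\<Union>M) = sum card M"
    using assms(2) by (intro card_Union_disjoint) (auto simp: is_matching_def)
  then show ?thesis
    using e by simp
qed

lemma Union_matching_subset:
  assumes "simple_graph \<Gamma>" "is_matching \<Gamma> M"
  shows "\<Union>M \<subseteq> fst \<Gamma>"
  using assms by (fastforce simp: simple_graph_def is_matching_def)

lemma matching_card_le:
  assumes "simple_graph \<Gamma>" "finite (fst \<Gamma>)" "is_matching \<Gamma> M"
  shows "2 * card M \<le> card (fst \<Gamma>)"
  using assms by (metis card_Union_matching Union_matching_subset card_mono)

lemma is_matching_subset:
  "is_matching \<Gamma> M \<Longrightarrow> N \<subseteq> M \<Longrightarrow> is_matching \<Gamma> N"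
  by (auto simp: is_matching_def intro: pairwise_subset)

lemma finite_matching:
  assumes "simple_graph \<Gamma>" "finite (fst \<Gamma>)" "is_matching \<Gamma> M"
  shows "finite M"
  using assms by (meson Union_matching_subset finite_UnionD finite_subset)

lemma matching_number_eqI:
  assumes "is_matching \<Gamma> M" "\<And>N. is_matching \<Gamma> N \<Longrightarrow> card N \<le> card M"
  shows "matching_number \<Gamma> = card M"
  unfolding matching_number_def
proof (rule Max_eqI)
  \<comment> \<open>\<open>Max\<close> needs a finite set; the common bound \<open>card M\<close>
    supplies it, so the graph itself may be infinite.\<close>
  show "finite {card M | M. is_matching \<Gamma> M}"
    by (rule finite_subset[of _ "{..card M}"]) (use assms in auto)
qed (use assms in auto)

text \<open>Edges inside an odd part leave at least one of its vertices uncovered, so each of the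
  \<open>card I\<close> parts costs a vertex. At most one further edge, through \<open>z\<close>,
  can rescue such a vertex.\<close>

lemma matching_card_le_odd_parts:
  fixes C :: "'i \<Rightarrow> 'v set"
  assumes "simple_graph \<Gamma>" and fin: "finite (fst \<Gamma>)" and M: "is_matching \<Gamma> M"
    and z: "z \<in> fst \<Gamma>" and I: "finite I"
    and C: "\<And>i. i \<in> I \<Longrightarrow> C i \<subseteq> fst \<Gamma> - {z}" "\<And>i. i \<in> I \<Longrightarrow> odd (card (C i))"
    and disj: "\<And>i j. i \<in> I \<Longrightarrow> j \<in> I \<Longrightarrow> i \<noteq> j \<Longrightarrow> C i \<inter> C j = {}"
    and edge: "\<And>e. e \<in> snd \<Gamma> \<Longrightarrow> z \<notin> e \<Longrightarrow> \<exists>i\<in>I. e \<subseteq> C i"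
  shows "2 * card M + card I \<le> card (fst \<Gamma>) + 1"
proof -
  define N where "N i = {e \<in> M. e \<subseteq> C i}" for i
  have finM: "finite M"
    using assms(1) fin M by (rule finite_matching)
  have finC: "finite (C i)" if "i \<in> I" for i
    using C(1)[OF that] fin by (meson finite_Diff finite_subset)
  have N: "2 * card (N i) + 1 \<le> card (C i)" if i: "i \<in> I" for i
  proof -
    have "2 * card (N i) = card (\<Union>(N i))"
      using M by (intro card_Union_matching[symmetric, OF assms(1)])
        (auto simp: N_def intro: is_matching_subset)
    also have "\<dots> \<le> card (C i)"
      by (rule card_mono) (auto simp: finC i N_def)
    \<comment> \<open>An even number bounded by an odd one is strictly smaller; this is the vertex
      lost in each part.\<close>
    finally show ?thesis
      using C(2)[OF i] by (metis Suc_eq_plus1 Suc_leI dvd_triv_left le_neq_implies_less)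
  qed
  have "{e \<in> M. z \<in> e} \<subseteq> {e}" if "e \<in> M" "z \<in> e" for e
    using M that by (auto simp: is_matching_def pairwise_def disjnt_iff)
  \<comment> \<open>If no edge of \<open>M\<close> contains \<open>z\<close>, any \<open>e\<close>
    will do.\<close>
  then obtain e where "{e \<in> M. z \<in> e} \<subseteq> {e}"
    by blast
  then have z_le: "card {e \<in> M. z \<in> e} \<le> 1"
    using card_mono[of "{e}"] by fastforce
  have "M \<subseteq> {e \<in> M. z \<in> e} \<union> (\<Union>i\<in>I. N i)"
    using edge M by (auto simp: N_def is_matching_def)
  then have "card M \<le> card ({e \<in> M. z \<in> e} \<union> (\<Union>i\<in>I. N i))"
    using finM I by (intro card_mono) (auto simp: N_def)
  also have "\<dots> \<le> card {e \<in> M. z \<in> e} + card (\<Union>i\<in>I. N i)"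
    by (rule card_Un_le)
  also have "\<dots> \<le> 1 + (\<Sum>i\<in>I. card (N i))"
    using z_le card_UN_le[OF I] by (intro add_mono) auto
  finally have "2 * card M + card I \<le> 2 + (\<Sum>i\<in>I. 2 * card (N i) + 1)"
    by (simp only: sum.distrib sum_distrib_left[symmetric] sum_constant) simp
  also have "\<dots> \<le> 2 + (\<Sum>i\<in>I. card (C i))"
    by (intro add_left_mono sum_mono N)
  also have "(\<Sum>i\<in>I. card (C i)) = card (\<Union>i\<in>I. C i)"
    using I finC disj by (intro card_UN_disjoint[symmetric]) auto
  also have "\<dots> \<le> card (fst \<Gamma> - {z})"
    using C(1) fin by (intro card_mono) auto
  \<comment> \<open>The 2 is the doubled edge at \<open>z\<close>; removing the vertex
    \<open>z\<close> takes one back.\<close>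
  also have "2 + card (fst \<Gamma> - {z}) = card (fst \<Gamma>) + 1"
    by (simp add: card.remove[OF fin z])
  finally show ?thesis by simp
qed

text \<open>The orbits of a fixed-point-free self-inverse map are disjoint two-element sets. They
  serve below both as matching edges and as a parity argument. For infinite \<open>S\<close> both
  cardinalities are 0.\<close>

lemma involution_pairs:
  assumes "\<And>x. x \<in> S \<Longrightarrow> f x \<in> S \<and> f (f x) = x \<and> f x \<noteq> x"
  shows "pairwise disjnt ((\<lambda>x. {x, f x}) ` S)"
    and "2 * card ((\<lambda>x. {x, f x}) ` S) = card S"
proof -
  show disj: "pairwise disjnt ((\<lambda>x. {x, f x}) ` S)"
    unfolding pairwise_image
  proof (rule pairwiseI, rule impI)
    fix x y assume "x \<in> S" "y \<in> S" and ne: "{x, f x} \<noteq> {y, f y}"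
    then have ff: "f (f x) = x" "f (f y) = y"
      using assms by blast+
    have "x \<noteq> y"
      using ne by blast
    moreover have "x \<noteq> f y" "f x \<noteq> y"
      using ne ff by (metis insert_commute)+
    moreover have "f x \<noteq> f y"
      using \<open>x \<noteq> y\<close> ff by metis
    ultimately show "disjnt {x, f x} {y, f y}"
      by (simp add: disjnt_def)
  qed
  have "card (\<Union>((\<lambda>x. {x, f x}) ` S)) = sum card ((\<lambda>x. {x, f x}) ` S)"
    using disj by (rule card_Union_disjoint) auto
  also have "\<dots> = (\<Sum>e\<in>(\<lambda>x. {x, f x}) ` S. 2)"
  proof (rule sum.cong)
    fix e assume "e \<in> (\<lambda>x. {x, f x}) ` S"
    then obtain x where "x \<in> S" "e = {x, f x}"
      by blast
    moreover from this have "x \<noteq> f x"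
      using assms by metis
    ultimately show "card e = 2"
      by simp
  qed simp
  also have "\<Union>((\<lambda>x. {x, f x}) ` S) = S"
    using assms by auto
  finally show "2 * card ((\<lambda>x. {x, f x}) ` S) = card S"
    by simp
qed

section \<open>Inversion, powers and involutions in a group\<close>

context group
begin

text \<open>Being self-inverse means x^2 = 1, so the order divides the prime 2. These are exactly
  the vertices missed by pairing elements with their inverses.\<close>

lemma inv_eq_self_iff:
  assumes "x \<in> carrier G"
  shows "inv x = x \<longleftrightarrow> x = \<one> \<or> x \<in> involutions G"
proof -
  have "inv x = x \<longleftrightarrow> x \<otimes> x = \<one>"
    using assms by (metis inv_equality r_inv)
  also have "\<dots> \<longleftrightarrow> x [^] (2::nat) = \<one>"
    using assms by (simp add: numeral_2_eq_2)
  also have "\<dots> \<longleftrightarrow> ord x dvd 2"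
    using assms by (rule pow_eq_id)
  also have "\<dots> \<longleftrightarrow> ord x = 1 \<or> ord x = 2"
    using prime_nat_iff two_is_prime_nat by auto
  finally show ?thesis
    using assms ord_eq_1 by (auto simp: involutions_def)
qed

lemma one_notin_involutions: "\<one> \<notin> involutions G"
  by (simp add: involutions_def)

lemma is_power_of_refl: "x \<in> carrier G \<Longrightarrow> is_power_of G x x"
  unfolding is_power_of_def by (rule exI[of _ 1]) simp

lemma is_power_of_trans:
  "x \<in> carrier G \<Longrightarrow> is_power_of G z y \<Longrightarrow> is_power_of G y x \<Longrightarrow> is_power_of G z x"
  unfolding is_power_of_def by (metis int_pow_pow)

lemma is_power_of_inv: "x \<in> carrier G \<Longrightarrow> is_power_of G (inv x) x"
  unfolding is_power_of_def by (rule exI[of _ "-1"]) (simp add: int_pow_neg)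

text \<open>A cyclic group has at most one involution. If x^k is one, then \<open>ord x\<close>
  divides 2k but not k, so 2k is an odd multiple of \<open>ord x\<close>. Two such multiples differ
  by an even one, so the exponents agree modulo \<open>ord x\<close>.\<close>

lemma involution_power_unique:
  assumes x: "x \<in> carrier G" and u: "u \<in> involutions G" "is_power_of G u x"
    and v: "v \<in> involutions G" "is_power_of G v x"
  shows "u = v"
proof -
  have half: "\<exists>k a. w = x [^] k \<and> 2 * k = int (ord x) * a \<and> odd a"
    if w: "w \<in> involutions G" "is_power_of G w x" for w
  proof -
    obtain k :: int where k: "w = x [^] k"
      using w(2) by (auto simp: is_power_of_def)
    have "w \<in> carrier G" "ord w = 2"
      using w(1) by (auto simp: involutions_def)
    then have "w [^] (2::int) = \<one>" "w \<noteq> \<one>"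
      using int_pow_eq_id[of w 2] by auto
    then have "int (ord x) dvd 2 * k" and not_dvd: "\<not> int (ord x) dvd k"
      using x by (auto simp: k int_pow_pow int_pow_eq_id mult.commute)
    then obtain a where a: "2 * k = int (ord x) * a"
      by (auto elim: dvdE)
    have "odd a"
    proof
      assume "even a"
      then obtain b where "a = 2 * b" ..
      with a not_dvd show False by auto
    qed
    with k a show ?thesis by blast
  qed
  obtain k a where k: "u = x [^] k" "2 * k = int (ord x) * a" "odd a"
    using half[OF u] by blast
  obtain l b where l: "v = x [^] l" "2 * l = int (ord x) * b" "odd b"
    using half[OF v] by blast
  have "even (b - a)"
    using k(3) l(3) by simp
  then obtain c where "b - a = 2 * c" ..
  then have "2 * (l - k) = 2 * (int (ord x) * c)"
    using k(2) l(2) by (metis mult.left_commute right_diff_distrib)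
  then have "l - k = int (ord x) * c"
    by (metis mult_cancel_left zero_neq_numeral)
  then have "int (ord x) dvd l - k" by simp
  then show ?thesis
    using x by (simp add: k(1) l(1) int_pow_eq)
qed

lemma ex_involution_power:
  assumes "finite (carrier G)" and x: "x \<in> carrier G" and "even (ord x)"
  shows "\<exists>u\<in>involutions G. is_power_of G u x"
proof -
  \<comment> \<open>Elements of infinite order have \<open>ord\<close> 0, which is even; finiteness
    excludes them.\<close>
  have pos: "ord x > 0"
    using assms ord_ge_1 by fastforce
  obtain m where m: "ord x = 2 * m"
    using assms(3) by blast
  have "ord (x [^] m) = 2"
    using ord_pow[OF x, of m] m pos by simp
  then have "x [^] m \<in> involutions G"
    using x by (simp add: involutions_def)
  moreover have "is_power_of G (x [^] m) x"
    unfolding is_power_of_def by (rule exI[of _ "int m"]) (simp add: int_pow_int)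
  ultimately show ?thesis by blast
qed

lemma ex_involution_power_2_group:
  assumes "finite (carrier G)" "order G = 2 ^ n" and x: "x \<in> carrier G" "x \<noteq> \<one>"
  shows "\<exists>u\<in>involutions G. is_power_of G u x"
proof -
  have "ord x dvd 2 ^ n"
    using ord_dvd_group_order[OF x(1)] assms(2) by simp
  then obtain k where k: "ord x = 2 ^ k"
    by (metis divides_primepow_nat two_is_prime_nat)
  then have "even (ord x)"
    using x ord_eq_1[OF x(1)] by (cases k) auto
  then show ?thesis
    using assms(1) x(1) ex_involution_power by blast
qed

text \<open>The elements other than \<open>u\<close> pair off with their inverses. A self-inverse
  one is the identity, whose powers are trivial, or an involution x; then x and \<open>u\<close> are
  both involutions among the powers of x, hence equal.\<close>

lemma odd_card_roots_of_involution:
  assumes "finite (carrier G)" and u: "u \<in> involutions G"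
  shows "odd (card {x \<in> carrier G. is_power_of G u x})"
proof -
  define C where "C = {x \<in> carrier G. is_power_of G u x}"
  have uG: "u \<in> carrier G"
    using u by (simp add: involutions_def)
  have fixed: "x = u" if "x \<in> C" "inv x = x" for x
  proof -
    have x: "x \<in> carrier G" "is_power_of G u x"
      using that by (auto simp: C_def)
    have "x \<noteq> \<one>"
      using x u one_notin_involutions by (auto simp: is_power_of_def)
    then have "x \<in> involutions G"
      using inv_eq_self_iff x(1) that(2) by blast
    then show ?thesis
      using involution_power_unique x u is_power_of_refl by blast
  qed
  \<comment> \<open>Here x is itself a power of its inverse, so transitivity applies.\<close>
  have inv_C: "inv x \<in> C" if "x \<in> C" for x
    using that is_power_of_inv[of "inv x"] by (auto simp: C_def intro: is_power_of_trans)
  have inv_u: "inv u = u"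
    using u uG inv_eq_self_iff by blast
  have "2 * card ((\<lambda>x. {x, inv x}) ` (C - {u})) = card (C - {u})"
  proof (rule involution_pairs(2))
    fix x assume x: "x \<in> C - {u}"
    then have "x \<in> carrier G" by (simp add: C_def)
    then have "inv x \<noteq> u"
      using x inv_u by (metis Diff_iff inv_inv singletonI)
    then show "inv x \<in> C - {u} \<and> inv (inv x) = x \<and> inv x \<noteq> x"
      using x inv_C fixed \<open>x \<in> carrier G\<close> by auto
  qed
  moreover have "card C = Suc (card (C - {u}))"
    using assms(1) is_power_of_refl uG by (intro card.remove) (auto simp: C_def)
  ultimately show ?thesis
    unfolding C_def[symmetric] by (metis dvd_triv_left even_Suc)
qed

section \<open>Matchings in the power graph: construction and upper bound\<close>

lemma power_graph_inverse_matching: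
  fixes S defines "S \<equiv> carrier G - insert \<one> (involutions G)"
  shows "is_matching (power_graph G) ((\<lambda>x. {x, inv x}) ` S)"
    and "2 * card ((\<lambda>x. {x, inv x}) ` S) = card S"
proof -
  have *: "inv x \<in> S \<and> inv (inv x) = x \<and> inv x \<noteq> x" if "x \<in> S" for x
    using that by (auto simp: S_def involutions_def inv_eq_1_iff inv_eq_self_iff)
  show "2 * card ((\<lambda>x. {x, inv x}) ` S) = card S"
    using * by (rule involution_pairs(2))
  have "(\<lambda>x. {x, inv x}) ` S \<subseteq> snd (power_graph G)"
  proof
    fix e assume "e \<in> (\<lambda>x. {x, inv x}) ` S"
    then obtain x where x: "x \<in> S" "e = {x, inv x}" by blast
    then have "x \<in> carrier G" by (simp add: S_def)
    then show "e \<in> snd (power_graph G)"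
      using *[OF x(1)] is_power_of_inv unfolding x(2) power_graph_def snd_conv
      by (intro CollectI exI[of _ x] exI[of _ "inv x"]) auto
  qed
  then show "is_matching (power_graph G) ((\<lambda>x. {x, inv x}) ` S)"
    using involution_pairs(1)[of S "\<lambda>x. inv x"] * by (simp add: is_matching_def)
qed

lemma power_graph_matching_no_involutions:
  assumes "finite (carrier G)" "involutions G = {}"
  obtains M where "is_matching (power_graph G) M" "2 * card M + 1 = order G"
proof
  let ?M = "(\<lambda>x. {x, inv x}) ` (carrier G - insert \<one> (involutions G))"
  show "is_matching (power_graph G) ?M"
    by (rule power_graph_inverse_matching)
  show "2 * card ?M + 1 = order G"
    unfolding power_graph_inverse_matching(2)
    using card.remove[OF assms(1) one_closed] assms(2) by (simp add: order_def)
qed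

lemma power_graph_matching_involutions:
  assumes fin: "finite (carrier G)" and "u \<in> involutions G"
  obtains M where "is_matching (power_graph G) M"
    "2 * card M + card (involutions G) = order G + 1"
proof
  define S where "S = carrier G - insert \<one> (involutions G)"
  define M where "M = (\<lambda>x. {x, inv x}) ` S"
  note M = power_graph_inverse_matching[folded S_def, folded M_def]
  have u: "u \<in> carrier G" "u \<noteq> \<one>" "inv u = u"
    using assms(2) one_notin_involutions inv_eq_self_iff by (auto simp: involutions_def)
  have sub: "involutions G \<subseteq> carrier G"
    by (auto simp: involutions_def)
  have "e \<subseteq> S" if "e \<in> M" for e
    using that unfolding M_def S_def
    by (auto simp: involutions_def inv_eq_1_iff)
  then have disj: "disjnt {\<one>, u} e" if "e \<in> M" for e
    using that assms(2) by (auto simp: S_def disjnt_iff)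
  \<comment> \<open>The exponent 0 makes the identity adjacent to every other vertex. Both ends of
    this new edge lie outside \<open>S\<close>, so it meets no inverse pair.\<close>
  have "is_power_of G \<one> u"
    unfolding is_power_of_def by (rule exI[of _ 0]) simp
  then have "{\<one>, u} \<in> snd (power_graph G)"
    using u unfolding power_graph_def snd_conv
    by (intro CollectI exI[of _ \<one>] exI[of _ u]) auto
  then show "is_matching (power_graph G) (insert {\<one>, u} M)"
    using M(1) disj by (auto simp: is_matching_def pairwise_insert disjnt_sym)
  have "{\<one>, u} \<notin> M"
    using disj by (auto simp: disjnt_iff)
  moreover have "finite M"
    using fin by (simp add: M_def S_def)
  \<comment> \<open>With t involutions, \<open>S\<close> has order(G) - t - 1 elements, so the
    enlarged matching covers order(G) - t + 1 vertices.\<close>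
  ultimately have "2 * card (insert {\<one>, u} M) = card S + 2"
    using M(2) by simp
  moreover have "card S + card (insert \<one> (involutions G)) = card (carrier G)"
    unfolding S_def using card_Diff_subset card_mono fin sub
    by (metis finite_subset insert_subset le_add_diff_inverse2 one_closed)
  ultimately show "2 * card (insert {\<one>, u} M) + card (involutions G) = order G + 1"
    using one_notin_involutions finite_subset[OF sub fin] by (simp add: order_def)
qed

text \<open>The odd-parts bound is used with the identity as deleted vertex and one part for each
  involution \<open>u\<close>: the elements having \<open>u\<close> as a power.\<close>

lemma power_graph_matching_le:
  assumes fin: "finite (carrier G)" and "order G = 2 ^ n"
    and M: "is_matching (power_graph G) M"
  shows "2 * card M + card (involutions G) \<le> order G + 1"
proof -
  define C where "C u = {x \<in> carrier G. is_power_of G u x}" for u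
  have "2 * card M + card (involutions G) \<le> card (fst (power_graph G)) + 1"
  proof (rule matching_card_le_odd_parts[OF simple_graph_power_graph _ M])
    show "finite (fst (power_graph G))" "\<one> \<in> fst (power_graph G)"
      using fin by (auto simp: power_graph_def)
    show "finite (involutions G)"
      using fin by (simp add: involutions_def)
    show "C u \<subseteq> fst (power_graph G) - {\<one>}" if "u \<in> involutions G" for u
      using that one_notin_involutions by (auto simp: C_def power_graph_def is_power_of_def)
    show "odd (card (C u))" if "u \<in> involutions G" for u
      unfolding C_def using fin that by (rule odd_card_roots_of_involution)
    show "C u \<inter> C v = {}" if "u \<in> involutions G" "v \<in> involutions G" "u \<noteq> v" for u v
      using that involution_power_unique by (auto simp: C_def)
    show "\<exists>u\<in>involutions G. e \<subseteq> C u" if e: "e \<in> snd (power_graph G)" "\<one> \<notin> e" for e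
    proof -
      \<comment> \<open>Name the ends so that y is a power of x. As y is not the identity, some
        involution is a power of y, hence also of x, and both ends lie in the same part.\<close>
      obtain x y where xy: "e = {x, y}" "x \<in> carrier G" "y \<in> carrier G" "is_power_of G y x"
        using e(1) by (auto simp: power_graph_def insert_commute)
      then obtain u where u: "u \<in> involutions G" "is_power_of G u y"
        using ex_involution_power_2_group fin assms(2) e(2) by blast
      then have "is_power_of G u x"
        using xy is_power_of_trans by blast
      then have "e \<subseteq> C u"
        using xy u(2) by (simp add: C_def)
      with u(1) show ?thesis by blast
    qed
  qed
  then show ?thesis
    by (simp add: power_graph_def order_def)
qed

end

text \<open>The last hypothesis excludes the trivial group for p = 2: there t = 0 and the formula
  would give 1, while the graph has no edge.\<close>

theorem theorem3p12:
  fixes G :: "('a, 'b) monoid_scheme" and p n :: nat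
  assumes "prime p"
    and "group G" and "finite (carrier G)" and "order G = p ^ n"
    and "p = 2 \<Longrightarrow> carrier G \<noteq> {\<one>\<^bsub>G\<^esub>}"
  shows "real (matching_number (power_graph G)) =
    (if p > 2 then (real (order G) - 1) / 2
     else (real (order G) - (real (card (involutions G)) - 1)) / 2)"
proof -
  interpret group G by fact
  show ?thesis
  proof (cases "p > 2")
    case True
    then have "odd (order G)"
      using assms(1,4) prime_odd_nat by auto
    \<comment> \<open>The order of an element divides the odd group order, so it cannot be
      2.\<close>
    then have "involutions G = {}"
      using ord_dvd_group_order by (fastforce simp: involutions_def)
    then obtain M where M: "is_matching (power_graph G) M" "2 * card M + 1 = order G"
      using power_graph_matching_no_involutions assms(3) by blast
    have "matching_number (power_graph G) = card M"
    proof (rule matching_number_eqI[OF M(1)])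
      fix N assume "is_matching (power_graph G) N"
      then have "2 * card N \<le> order G"
        using matching_card_le[OF simple_graph_power_graph[of G]] assms(3)
        by (simp add: power_graph_def order_def)
      \<comment> \<open>Integrality absorbs the one missed vertex: 2 * card N is at most 2 * card M
        + 1.\<close>
      then show "card N \<le> card M"
        using M(2) by linarith
    qed
    then show ?thesis
      using True M(2) by (simp flip: M(2))
  next
    case False
    then have p: "p = 2"
      using prime_ge_2_nat[OF assms(1)] by simp
    obtain x where x: "x \<in> carrier G" "x \<noteq> \<one>\<^bsub>G\<^esub>"
      using assms(5)[OF p] one_closed by blast
    obtain u where "u \<in> involutions G"
      using ex_involution_power_2_group assms(3,4) p x by blast
    then obtain M where M: "is_matching (power_graph G) M"
        "2 * card M + card (involutions G) = order G + 1"
      using power_graph_matching_involutions assms(3) by blast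
    have "matching_number (power_graph G) = card M"
    proof (rule matching_number_eqI[OF M(1)])
      fix N assume "is_matching (power_graph G) N"
      then have "2 * card N + card (involutions G) \<le> order G + 1"
        using power_graph_matching_le assms(3,4) p by blast
      then show "card N \<le> card M"
        using M(2) by linarith
    qed
    moreover have "2 * real (card M) + real (card (involutions G)) = real (order G) + 1"
      using arg_cong[OF M(2), of real] by simp
    ultimately show ?thesis
      using False by simp
  qed
qed

end
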